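(* Let $U$ be a set, $E$ a finite set, and $G=(F,E)$ a covering soft set over $U$, with associated soft covering approximation space $S=(U,C_G)$. Then the following are equivalent: (i) for all $X,Y\subseteq U$, $X\subseteq Y$ implies $S^-(X)\subseteq S^-(Y)$; (ii) for all $X,Y\subseteq U$, $S^-(X\cup Y)=S^-(X)\cup S^-(Y)$.
   Context: A soft set over $U$ is a pair $G=(F,E)$ with $F:E\to P(U)$ a map into the power set of $U$. It is a covering soft set if $\bigcup_{e\in E}F(e)=U$ and $F(e)\neq\emptyset$ for every $e\in E$. Write $C_G=\{F(e):e\in E\}$; the pair $S=(U,C_G)$ is called a soft covering approximation space. For $x\in U$ the soft minimal description of $x$ is $Md_S(x)=\{F(e): e\in E,\ x\in F(e),\text{ and for all } a\in E,\ x\in F(a)\subseteq F(e)\text{ implies }F(a)=F(e)\}$, i.e. the family of inclusion-minimal members of $C_G$ containing $x$. For $X\subseteq U$ the soft covering lower approximation is $S_-(X)=\bigcup\{F(e): e\in E,\ F(e)\subseteq X\}$ and the soft covering upper approximation is $S^-(X)=S_-(X)\cup\bigcup_{x\in X\setminus S_-(X)}\ \bigcup_{K\in Md_S(x)}K$. *)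

theory Defs
  imports "HOL-Library.FuncSet"
begin

text \<open>
  A soft set \<open>(F, E)\<close> over \<open>U\<close> is given by a parameter set \<open>E\<close> and a map \<open>F\<close> whose
  values are only used on \<open>E\<close>.  The soft covering approximation space \<open>(U, C\<^sub>G)\<close>
  with \<open>C\<^sub>G = F ` E\<close> is not a separate object: the operators below take \<open>F\<close> and \<open>E\<close>
  and depend on them only through \<open>F ` E\<close>.
\<close>

definition soft_set :: "'a set \<Rightarrow> ('e \<Rightarrow> 'a set) \<Rightarrow> 'e set \<Rightarrow> bool" where
  "soft_set U F E \<longleftrightarrow> F \<in> E \<rightarrow> Pow U"

definition covering_soft_set :: "'a set \<Rightarrow> ('e \<Rightarrow> 'a set) \<Rightarrow> 'e set \<Rightarrow> bool" where
  "covering_soft_set U F E \<longleftrightarrow>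
     soft_set U F E \<and> (\<Union>e\<in>E. F e) = U \<and> (\<forall>e\<in>E. F e \<noteq> {})"

definition soft_min_desc :: "('e \<Rightarrow> 'a set) \<Rightarrow> 'e set \<Rightarrow> 'a \<Rightarrow> 'a set set" where
  "soft_min_desc F E x =
     {F e | e. e \<in> E \<and> x \<in> F e \<and> (\<forall>a\<in>E. x \<in> F a \<and> F a \<subseteq> F e \<longrightarrow> F a = F e)}"

definition soft_lower :: "('e \<Rightarrow> 'a set) \<Rightarrow> 'e set \<Rightarrow> 'a set \<Rightarrow> 'a set" where
  "soft_lower F E X = \<Union>{F e | e. e \<in> E \<and> F e \<subseteq> X}"

definition soft_upper :: "('e \<Rightarrow> 'a set) \<Rightarrow> 'e set \<Rightarrow> 'a set \<Rightarrow> 'a set" where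
  "soft_upper F E X =
     soft_lower F E X \<union> (\<Union>x\<in>X - soft_lower F E X. \<Union>K\<in>soft_min_desc F E x. K)"

end

theory Submission
  imports Defs
begin

text \<open>
  Write \<open>N x\<close> for the union of the minimal description of \<open>x\<close>.  Always
  \<open>S\<^sup>-({x}) = N x\<close> and, since finiteness of \<open>E\<close> gives \<open>x \<in> N x\<close>, also
  \<open>S\<^sup>-(X) \<subseteq> (\<Union>x\<in>X. N x)\<close>.  If \<open>S\<^sup>-\<close> is monotone, then
  \<open>N x = S\<^sup>-({x}) \<subseteq> S\<^sup>-(X)\<close> for \<open>x \<in> X\<close>, so \<open>S\<^sup>-(X) = (\<Union>x\<in>X. N x)\<close>, which is
  additive in \<open>X\<close>.
\<close>

lemma mem_Union_soft_min_desc: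
  assumes "finite E" and "e \<in> E" and "x \<in> F e"
  shows "x \<in> \<Union>(soft_min_desc F E x)"
proof -
  let ?A = "{K \<in> F ` E. x \<in> K}"
  have "finite ?A" and "?A \<noteq> {}"
    using assms by auto
  then obtain K where "K \<in> ?A" and "\<forall>L\<in>?A. L \<subseteq> K \<longrightarrow> K = L"
    using finite_has_minimal[of ?A] by auto
  then have "K \<in> soft_min_desc F E x"
    unfolding soft_min_desc_def by blast
  with \<open>K \<in> ?A\<close> show ?thesis
    by blast
qed

text \<open>If \<open>{x}\<close> is a block, it is the only minimal block at \<open>x\<close> and
  both sides equal \<open>{x}\<close>; otherwise the lower approximation is empty.\<close>

lemma soft_upper_singleton:
  assumes "\<forall>e\<in>E. F e \<noteq> {}"
  shows "soft_upper F E {x} = \<Union>(soft_min_desc F E x)"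
proof (cases "{x} \<in> F ` E")
  case True
  then obtain e where e: "e \<in> E" "F e = {x}"
    by auto
  have "soft_lower F E {x} = {x}"
    unfolding soft_lower_def using e by blast
  moreover have "soft_min_desc F E x = {{x}}"
  proof
    show "soft_min_desc F E x \<subseteq> {{x}}"
    proof
      fix K
      assume "K \<in> soft_min_desc F E x"
      then have "x \<in> K" and "\<forall>a\<in>E. x \<in> F a \<and> F a \<subseteq> K \<longrightarrow> F a = K"
        unfolding soft_min_desc_def by auto
      \<comment> \<open>The block \<open>F e = {x}\<close> lies inside \<open>K\<close>, so
        minimality of \<open>K\<close> forces equality.\<close>
      with e have "K = {x}"
        by fastforce
      then show "K \<in> {{x}}"
        by simp
    qed
    have "\<forall>a\<in>E. x \<in> F a \<and> F a \<subseteq> F e \<longrightarrow> F a = F e"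
      using e by auto
    then show "{{x}} \<subseteq> soft_min_desc F E x"
      unfolding soft_min_desc_def using e by blast
  qed
  ultimately show ?thesis
    unfolding soft_upper_def by simp
next
  case False
  then have "soft_lower F E {x} = {}"
    \<comment> \<open>A block inside \<open>{x}\<close> would be \<open>{}\<close> or
      \<open>{x}\<close>: nonemptiness excludes the first, the case assumption the second.\<close>
    unfolding soft_lower_def using assms by (auto simp: subset_singleton_iff)
  then show ?thesis
    unfolding soft_upper_def by simp
qed

text \<open>Only the lower approximation needs an argument: each of its points lies in
  \<open>X\<close> and in a minimal block of its own.\<close>

lemma soft_upper_subset:
  assumes "finite E"
  shows "soft_upper F E X \<subseteq> (\<Union>x\<in>X. \<Union>(soft_min_desc F E x))"
proof -
  have "soft_lower F E X \<subseteq> (\<Union>x\<in>X. \<Union>(soft_min_desc F E x))"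
  proof
    fix x
    assume "x \<in> soft_lower F E X"
    then obtain e where "e \<in> E" "x \<in> F e" "x \<in> X"
      unfolding soft_lower_def by auto
    then show "x \<in> (\<Union>x\<in>X. \<Union>(soft_min_desc F E x))"
      using mem_Union_soft_min_desc[OF assms] by (metis UN_I)
  qed
  then show ?thesis
    unfolding soft_upper_def by blast
qed

theorem theorem22:
  fixes U :: "'a set" and E :: "'e set" and F :: "'e \<Rightarrow> 'a set"
  assumes "finite E"
    and "covering_soft_set U F E"
  shows "(\<forall>X Y. X \<subseteq> U \<and> Y \<subseteq> U \<longrightarrow> X \<subseteq> Y \<longrightarrow> soft_upper F E X \<subseteq> soft_upper F E Y)
     \<longleftrightarrow> (\<forall>X Y. X \<subseteq> U \<and> Y \<subseteq> U \<longrightarrow>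
            soft_upper F E (X \<union> Y) = soft_upper F E X \<union> soft_upper F E Y)"
    (is "?mono \<longleftrightarrow> ?additive")
proof
  assume mono: ?mono
  have nonempty: "\<forall>e\<in>E. F e \<noteq> {}"
    using assms(2) unfolding covering_soft_set_def by blast
  have upper: "soft_upper F E X = (\<Union>x\<in>X. \<Union>(soft_min_desc F E x))" if "X \<subseteq> U" for X
  proof
    show "soft_upper F E X \<subseteq> (\<Union>x\<in>X. \<Union>(soft_min_desc F E x))"
      by (rule soft_upper_subset[OF assms(1)])
    have "soft_upper F E {x} \<subseteq> soft_upper F E X" if "x \<in> X" for x
    proof -
      have "{x} \<subseteq> X" and "{x} \<subseteq> U"
        using \<open>X \<subseteq> U\<close> that by auto
      with mono \<open>X \<subseteq> U\<close> show ?thesis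
        by blast
    qed
    then show "(\<Union>x\<in>X. \<Union>(soft_min_desc F E x)) \<subseteq> soft_upper F E X"
      unfolding soft_upper_singleton[OF nonempty] by blast
  qed
  show ?additive
  proof (intro allI impI)
    fix X Y
    assume "X \<subseteq> U \<and> Y \<subseteq> U"
    then have "X \<subseteq> U" and "Y \<subseteq> U" and "X \<union> Y \<subseteq> U"
      by auto
    then show "soft_upper F E (X \<union> Y) = soft_upper F E X \<union> soft_upper F E Y"
      by (simp only: upper UN_Un)
  qed
next
  assume additive: ?additive
  show ?mono
  proof (intro allI impI)
    fix X Y
    assume "X \<subseteq> U \<and> Y \<subseteq> U" and "X \<subseteq> Y"
    \<comment> \<open>Since \<open>X \<union> Y\<close> is just \<open>Y\<close>, additivity
      exhibits the upper approximation of \<open>X\<close> as a part of that of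
      \<open>Y\<close>.\<close>
    then have "soft_upper F E (X \<union> Y) = soft_upper F E X \<union> soft_upper F E Y"
      using additive by blast
    moreover have "X \<union> Y = Y"
      using \<open>X \<subseteq> Y\<close> by (rule Un_absorb1)
    ultimately show "soft_upper F E X \<subseteq> soft_upper F E Y"
      by auto
  qed
qed

end
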